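(* Let $m,n\ge 1$ be integers, $\alpha\in\mathbb R$ and $u\in C_c^{2m}(\mathbb R^n\setminus\{0\})$. Then $$\|\Delta_r^m u\|_\alpha^2=\prod_{\ell=0}^{m-1}A_{\alpha+4\ell}^2\,\|u\|_{\alpha+4m}^2+\sum_{j=0}^{2m-1}C_{j,m,\alpha}\,\big\|R_{\alpha+2j,\,2m-1-j}(u)\big\|_{\alpha+2j}^2,$$ where the (nonnegative) coefficients $C_{j,k,\alpha}$ are defined recursively by $C_{0,0,\alpha}=1$, $C_{j,k,\alpha}=0$ if $j<0$ or $j>2k$, and $$C_{j,k+1,\alpha}=A_{\alpha+4k}^2\,C_{j-2,k,\alpha}+D_{\alpha+4k}\,C_{j-1,k,\alpha}+C_{j,k,\alpha},\qquad 0\le j\le 2k+2,\ k\ge 0.$$ (In particular $C_{2m,m,\alpha}=\prod_{\ell=0}^{m-1}A_{\alpha+4\ell}^2$.)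
   Context: Let $n\ge1$ and write $r=|x|$ for $x\in\mathbb R^n$. For $\beta\in\mathbb R$ and $g$ continuous with compact support in $\mathbb R^n\setminus\{0\}$, set $\|g\|_\beta^2=\int_{\mathbb R^n}|g(x)|^2|x|^{-\beta}\,dx$. Let $\partial_r=\sum_{i=1}^n\frac{x_i}{r}\partial_{x_i}$ and $\Delta_r=\partial_r^2+\frac{n-1}{r}\partial_r$ (the radial Laplacian); $\Delta_r^m$ is its $m$-fold composition. For $\alpha\in\mathbb R$, $T_\alpha f=\partial_r f+\frac{n-2-\alpha}{2r}f$. For an integer $k\ge0$, $R_{\alpha,k}=T_\alpha\circ T_{\alpha+2}\circ\cdots\circ T_{\alpha+2k}$ (composition of $k+1$ operators, so $R_{\alpha,0}=T_\alpha$). For $\beta\in\mathbb R$, $A_\beta=\frac{(n+\beta)(n-4-\beta)}{4}$ and $D_\beta=\frac{(n+\beta)^2+(n-4-\beta)^2}{4}$. *)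

theory Defs
  imports "HOL-Analysis.Analysis"
begin

fun Ck_on :: "nat \<Rightarrow> ('a::euclidean_space \<Rightarrow> real) \<Rightarrow> 'a set \<Rightarrow> bool" where
  "Ck_on 0 f S = continuous_on S f"
| "Ck_on (Suc k) f S =
     (f differentiable_on S \<and> continuous_on S f \<and>
      (\<forall>i\<in>Basis. Ck_on k (\<lambda>x. frechet_derivative f (at x) i) S))"

definition supp :: "('a::real_normed_vector \<Rightarrow> real) \<Rightarrow> 'a set" where
  "supp f = closure {x. f x \<noteq> 0}"

definition compact_support_away_0 :: "('a::real_normed_vector \<Rightarrow> real) \<Rightarrow> bool" where
  "compact_support_away_0 f \<longleftrightarrow> compact (supp f) \<and> 0 \<notin> supp f"

definition wnorm2 :: "real \<Rightarrow> ('a::euclidean_space \<Rightarrow> real) \<Rightarrow> real" where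
  "wnorm2 \<beta> g = integral UNIV (\<lambda>x. \<bar>g x\<bar>^2 * norm x powr (-\<beta>))"

definition radial_deriv :: "('a::euclidean_space \<Rightarrow> real) \<Rightarrow> 'a \<Rightarrow> real" where
  "radial_deriv f x = frechet_derivative f (at x) (x /\<^sub>R norm x)"

definition radial_lap :: "('a::euclidean_space \<Rightarrow> real) \<Rightarrow> 'a \<Rightarrow> real" where
  "radial_lap f x = radial_deriv (radial_deriv f) x
     + (real DIM('a) - 1) / norm x * radial_deriv f x"

definition Top :: "real \<Rightarrow> ('a::euclidean_space \<Rightarrow> real) \<Rightarrow> 'a \<Rightarrow> real" where
  "Top \<alpha> f x = radial_deriv f x + (real DIM('a) - 2 - \<alpha>) / (2 * norm x) * f x"

fun Rop :: "real \<Rightarrow> nat \<Rightarrow> ('a::euclidean_space \<Rightarrow> real) \<Rightarrow> 'a \<Rightarrow> real" where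
  "Rop \<alpha> 0 f = Top \<alpha> f"
| "Rop \<alpha> (Suc k) f = Top \<alpha> (Rop (\<alpha> + 2) k f)"

definition Acoef :: "real \<Rightarrow> real \<Rightarrow> real" where
  "Acoef n \<beta> = (n + \<beta>) * (n - 4 - \<beta>) / 4"

definition Dcoef :: "real \<Rightarrow> real \<Rightarrow> real" where
  "Dcoef n \<beta> = ((n + \<beta>)^2 + (n - 4 - \<beta>)^2) / 4"

fun Ccoef :: "real \<Rightarrow> int \<Rightarrow> nat \<Rightarrow> real \<Rightarrow> real" where
  "Ccoef n j 0 \<alpha> = (if j = 0 then 1 else 0)"
| "Ccoef n j (Suc k) \<alpha> =
     (if j < 0 \<or> j > 2 * int k + 2 then 0
      else (Acoef n (\<alpha> + 4 * real k))^2 * Ccoef n (j - 2) k \<alpha>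
         + Dcoef n (\<alpha> + 4 * real k) * Ccoef n (j - 1) k \<alpha>
         + Ccoef n j k \<alpha>)"

end

theory Submission
  imports Defs
begin

text \<open>
  Let \<open>\<theta> = r \<partial>\<^sub>r\<close> be the Euler field (\<open>euler\<close>) and \<open>E\<^sub>\<beta> f = r powr ((\<beta> - n) / 2) * f\<close>
  (\<open>scale_to\<close>), so that \<open>wnorm2 \<beta> (E\<^sub>\<beta> f)\<close> is the \<open>L\<^sup>2\<close> norm of \<open>f\<close> for the dilation
  invariant measure \<open>r\<^sup>-\<^sup>n dx\<close>, with respect to which \<open>\<theta>\<close> is skew-adjoint. Conjugation by
  these isometries turns \<open>Top \<alpha>\<close> into \<open>\<theta>\<close> and the radial Laplacian into
  \<open>(\<theta> - c) (\<theta> + d)\<close> with \<open>c = (n - 4 - \<beta>) / 2\<close> and \<open>d = (n + \<beta>) / 2\<close>. Skew-adjointness gives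
  \<open>\<parallel>(\<theta> - c) (\<theta> + d) f\<parallel>\<^sup>2 = \<parallel>\<theta>\<^sup>2 f\<parallel>\<^sup>2 + (c\<^sup>2 + d\<^sup>2) \<parallel>\<theta> f\<parallel>\<^sup>2 + (c d)\<^sup>2 \<parallel>f\<parallel>\<^sup>2\<close>, where
  \<open>c\<^sup>2 + d\<^sup>2 = D\<^sub>\<beta>\<close> and \<open>c d = A\<^sub>\<beta>\<close>; iterating this produces the recursion for the coefficients.
\<close>

section \<open>Functions of class $C^k$\<close>

text \<open>The derivative at a point sees the function on a whole neighbourhood, so openness of S
  is what makes the class depend on the values on S alone.\<close>

lemma Ck_on_cong:
  assumes "open S" "\<And>x. x \<in> S \<Longrightarrow> f x = g x" "Ck_on k f S"
  shows "Ck_on k g S"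
  using assms(2,3)
proof (induction k arbitrary: f g)
  case 0
  then show ?case by (auto cong: continuous_on_cong)
next
  case (Suc k)
  have diff: "f differentiable at x" if "x \<in> S" for x
    using Suc.prems(2) that \<open>open S\<close> by (simp add: differentiable_on_eq_differentiable_at)
  have "g differentiable at x" if "x \<in> S" for x
    using diff[OF that] Suc.prems(1) has_derivative_transform_within_open[OF _ \<open>open S\<close> that]
    unfolding differentiable_def by meson
  moreover have "frechet_derivative f (at x) = frechet_derivative g (at x)" if "x \<in> S" for x
    using frechet_derivative_transform_within_open[OF diff[OF that] \<open>open S\<close> that Suc.prems(1)] .
  then have "Ck_on k (\<lambda>x. frechet_derivative g (at x) i) S" if "i \<in> Basis" for i
    using Suc.IH[of "\<lambda>x. frechet_derivative f (at x) i"] Suc.prems(2) that by auto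
  moreover have "continuous_on S g"
    using Suc.prems by (auto cong: continuous_on_cong)
  ultimately show ?case
    using \<open>open S\<close> by (simp add: differentiable_on_eq_differentiable_at)
qed

lemma Ck_on_imp_continuous: "Ck_on k f S \<Longrightarrow> continuous_on S f"
  by (cases k) auto

lemma Ck_on_Suc_has_derivative:
  assumes "open S" "Ck_on (Suc k) f S" "x \<in> S"
  shows "(f has_derivative frechet_derivative f (at x)) (at x)"
  using assms by (simp add: differentiable_on_eq_differentiable_at frechet_derivative_works)

lemma Ck_on_SucI:
  assumes "open S" "\<And>x. x \<in> S \<Longrightarrow> (f has_derivative f' x) (at x)"
    and "\<And>i. i \<in> Basis \<Longrightarrow> Ck_on k (\<lambda>x. f' x i) S"
  shows "Ck_on (Suc k) f S"
proof -
  have "f differentiable_on S"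
    using assms(1,2) by (auto simp: differentiable_on_eq_differentiable_at differentiable_def)
  moreover have "f' x = frechet_derivative f (at x)" if "x \<in> S" for x
    using assms(2)[OF that] by (rule frechet_derivative_at)
  then have "Ck_on k (\<lambda>x. frechet_derivative f (at x) i) S" if "i \<in> Basis" for i
    using Ck_on_cong[OF \<open>open S\<close> _ assms(3)[OF that]] by simp
  ultimately show ?thesis
    by (simp add: differentiable_imp_continuous_on)
qed

lemma Ck_on_SucD: "Ck_on (Suc k) f S \<Longrightarrow> Ck_on k f S"
  by (induction k arbitrary: f) auto

lemma Ck_on_const: "open S \<Longrightarrow> Ck_on k (\<lambda>x. c) S"
proof (induction k arbitrary: c)
  case (Suc k)
  then show ?case
    by (intro Ck_on_SucI[where f'="\<lambda>x h. 0"]) auto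
qed simp

lemma Ck_on_add:
  assumes "open S"
  shows "Ck_on k f S \<Longrightarrow> Ck_on k g S \<Longrightarrow> Ck_on k (\<lambda>x. f x + g x) S"
proof (induction k arbitrary: f g)
  case (Suc k)
  show ?case
  proof (rule Ck_on_SucI[OF \<open>open S\<close>])
    show "((\<lambda>x. f x + g x) has_derivative
        (\<lambda>h. frechet_derivative f (at x) h + frechet_derivative g (at x) h)) (at x)"
      if "x \<in> S" for x
      using Ck_on_Suc_has_derivative[OF \<open>open S\<close> Suc.prems(1) that]
        Ck_on_Suc_has_derivative[OF \<open>open S\<close> Suc.prems(2) that]
      by (rule has_derivative_add)
  qed (use Suc in auto)
qed (auto intro: continuous_intros)

lemma Ck_on_mult:
  assumes "open S"
  shows "Ck_on k f S \<Longrightarrow> Ck_on k g S \<Longrightarrow> Ck_on k (\<lambda>x. f x * g x) S"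
proof (induction k arbitrary: f g)
  case (Suc k)
  show ?case
  proof (rule Ck_on_SucI[OF \<open>open S\<close>])
    show "((\<lambda>x. f x * g x) has_derivative
        (\<lambda>h. f x * frechet_derivative g (at x) h + frechet_derivative f (at x) h * g x)) (at x)"
      if "x \<in> S" for x
      using Ck_on_Suc_has_derivative[OF \<open>open S\<close> Suc.prems(1) that]
        Ck_on_Suc_has_derivative[OF \<open>open S\<close> Suc.prems(2) that]
      by (rule has_derivative_mult)
    show "Ck_on k (\<lambda>x. f x * frechet_derivative g (at x) i
        + frechet_derivative f (at x) i * g x) S" if "i \<in> Basis" for i
      using that Suc.prems Ck_on_SucD[OF Suc.prems(1)] Ck_on_SucD[OF Suc.prems(2)]
      by (intro Ck_on_add[OF \<open>open S\<close>] Suc.IH) auto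
  qed
qed (auto intro: continuous_intros)

lemma Ck_on_sum:
  assumes "open S" "finite I" "\<And>i. i \<in> I \<Longrightarrow> Ck_on k (f i) S"
  shows "Ck_on k (\<lambda>x. \<Sum>i\<in>I. f i x) S"
  using assms(2,3) by (induction I rule: finite_induct)
    (auto intro: Ck_on_add[OF \<open>open S\<close>] Ck_on_const[OF \<open>open S\<close>])

lemma Ck_on_inner_right:
  assumes "open S"
  shows "Ck_on k (\<lambda>x. x \<bullet> v) S"
proof (cases k)
  case (Suc l)
  show ?thesis
    unfolding Suc
    by (rule Ck_on_SucI[OF assms, where f'="\<lambda>x h. h \<bullet> v"])
      (auto intro!: derivative_eq_intros Ck_on_const[OF assms])
qed (auto intro: continuous_intros)

lemma has_derivative_norm_powr:
  fixes x :: "'a::euclidean_space"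
  assumes "x \<noteq> 0"
  shows "((\<lambda>x. norm x powr \<gamma>) has_derivative (\<lambda>h. \<gamma> * norm x powr (\<gamma> - 2) * (x \<bullet> h))) (at x)"
proof -
  have "((\<lambda>x. norm x powr \<gamma>) has_derivative
      (\<lambda>h. norm x powr \<gamma> * (0 * ln (norm x) + (h \<bullet> sgn x) * \<gamma> / norm x))) (at x)"
    using assms by (auto intro!: derivative_eq_intros has_derivative_norm)
  moreover have "norm x powr \<gamma> * (0 * ln (norm x) + (h \<bullet> sgn x) * \<gamma> / norm x)
      = \<gamma> * norm x powr (\<gamma> - 2) * (x \<bullet> h)" for h
    using assms
    by (simp add: powr_diff sgn_div_norm inner_commute field_simps power2_eq_square)
  ultimately show ?thesis by simp
qed

text \<open>Each partial derivative of a power of the norm is a constant times a coordinate times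
  another such power, so the induction runs over all exponents at once.\<close>

lemma Ck_on_norm_powr: "Ck_on k (\<lambda>x::'a::euclidean_space. norm x powr \<gamma>) (UNIV - {0})"
proof (induction k arbitrary: \<gamma>)
  case 0
  show ?case by (auto intro!: continuous_intros)
next
  case (Suc k)
  have op: "open (UNIV - {0::'a})" by (simp add: open_delete)
  show ?case
    by (rule Ck_on_SucI[OF op, OF has_derivative_norm_powr])
      (auto intro!: Ck_on_mult[OF op] Ck_on_const[OF op] Suc Ck_on_inner_right[OF op])
qed

section \<open>The Euler field on compactly supported functions\<close>

definition euler :: "('a::euclidean_space \<Rightarrow> real) \<Rightarrow> 'a \<Rightarrow> real" where
  "euler f x = frechet_derivative f (at x) x"

text \<open>Confining the nonzero values to an annulus expresses compact support away from 0 without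
  closures, in a form that products, sums and derivatives inherit directly.\<close>

definition test_fun :: "nat \<Rightarrow> ('a::euclidean_space \<Rightarrow> real) \<Rightarrow> bool" where
  "test_fun k f \<longleftrightarrow> Ck_on k f (UNIV - {0}) \<and>
     (\<exists>a>0. \<exists>b. \<forall>x. f x \<noteq> 0 \<longrightarrow> a \<le> norm x \<and> norm x \<le> b)"

lemma test_funI:
  assumes "Ck_on k f (UNIV - {0})" "compact_support_away_0 f"
  shows "test_fun k f"
proof -
  have c: "compact (supp f)" and z: "0 \<notin> supp f"
    using assms(2) by (auto simp: compact_support_away_0_def)
  obtain b where b: "\<And>x. x \<in> supp f \<Longrightarrow> norm x \<le> b"
    using compact_imp_bounded[OF c] by (auto simp: bounded_iff)
  obtain a where a: "a > 0" "\<And>x. x \<in> supp f \<Longrightarrow> a \<le> dist 0 x"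
    using separate_point_closed[OF compact_imp_closed[OF c] z] by blast
  have "f x \<noteq> 0 \<Longrightarrow> x \<in> supp f" for x
    unfolding supp_def by (rule subsetD[OF closure_subset]) simp
  then show ?thesis
    using assms(1) a b unfolding test_fun_def by fastforce
qed

lemma test_fun_eventually_0:
  assumes "test_fun k f"
  obtains e where "e > 0" "\<And>x. norm x < e \<Longrightarrow> f x = 0"
  using assms unfolding test_fun_def by fastforce

lemma test_fun_at_0: "test_fun k f \<Longrightarrow> f 0 = 0"
  by (metis norm_zero test_fun_eventually_0)

lemma test_fun_SucD: "test_fun (Suc k) f \<Longrightarrow> test_fun k f"
  unfolding test_fun_def using Ck_on_SucD by blast

lemma test_fun_mono: "k \<le> l \<Longrightarrow> test_fun l f \<Longrightarrow> test_fun k f"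
  by (induction rule: inc_induct) (auto intro: test_fun_SucD)

lemma test_fun_continuous:
  assumes "test_fun k f"
  shows "continuous_on UNIV f"
proof -
  obtain e where e: "e > 0" "\<And>x. norm x < e \<Longrightarrow> f x = 0"
    using test_fun_eventually_0[OF assms] by blast
  have "continuous_on (UNIV - {0}) f"
    using assms by (auto simp: test_fun_def intro: Ck_on_imp_continuous)
  moreover have "continuous_on (ball 0 e) f"
    using e by (subst continuous_on_cong[OF refl, where g="\<lambda>_. 0"]) auto
  ultimately have "continuous_on ((UNIV - {0}) \<union> ball 0 e) f"
    by (intro continuous_on_open_Un) (auto simp: open_delete)
  moreover have "(UNIV - {0}) \<union> ball 0 e = UNIV"
    using e(1) by auto
  ultimately show ?thesis by metis
qed

text \<open>Near 0 the function vanishes identically, so the derivative exists at the origin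
  too.\<close>

lemma test_fun_has_derivative:
  assumes "test_fun (Suc k) f"
  shows "(f has_derivative frechet_derivative f (at x)) (at x)"
proof (cases "x = 0")
  case True
  obtain e where e: "e > 0" "\<And>x. norm x < e \<Longrightarrow> f x = 0"
    using test_fun_eventually_0[OF assms] by blast
  have "(f has_derivative (\<lambda>h. 0)) (at x)"
    by (rule has_derivative_transform_within_open[where f="\<lambda>_. 0" and s="ball 0 e"])
      (use e True in auto)
  then show ?thesis
    using frechet_derivative_at by metis
next
  case False
  then show ?thesis
    using assms by (intro Ck_on_Suc_has_derivative[where S="UNIV - {0}"])
      (auto simp: test_fun_def open_delete)
qed

lemma euler_eqI: "(f has_derivative f') (at x) \<Longrightarrow> euler f x = f' x"
  unfolding euler_def using frechet_derivative_at by metis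

lemma test_fun_euler:
  assumes "test_fun (Suc k) f"
  shows "test_fun k (euler f)"
proof -
  have op: "open (UNIV - {0::'a})" by (simp add: open_delete)
  have "euler f x = (\<Sum>i\<in>Basis. (x \<bullet> i) * frechet_derivative f (at x) i)" for x
  proof -
    interpret linear "frechet_derivative f (at x)"
      using test_fun_has_derivative[OF assms] by (rule has_derivative_linear)
    have "euler f x = frechet_derivative f (at x) (\<Sum>i\<in>Basis. (x \<bullet> i) *\<^sub>R i)"
      by (simp add: euler_def euclidean_representation)
    then show ?thesis by (simp add: sum scale)
  qed
  moreover have "Ck_on k (\<lambda>x. \<Sum>i\<in>Basis. (x \<bullet> i) * frechet_derivative f (at x) i) (UNIV - {0})"
    using assms by (intro Ck_on_sum[OF op] Ck_on_mult[OF op] Ck_on_inner_right[OF op])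
      (auto simp: test_fun_def)
  ultimately have "Ck_on k (euler f) (UNIV - {0})"
    by (auto intro: Ck_on_cong[OF op])
  moreover obtain a b where ab: "a > 0" "\<And>x. f x \<noteq> 0 \<Longrightarrow> a \<le> norm x \<and> norm x \<le> b"
    using assms unfolding test_fun_def by blast
  \<comment> \<open>The strict inequalities describe an open set on which f is 0, so the derivative
    is 0 there and the annulus for f also serves \<open>euler f\<close>.\<close>
  have "euler f x = 0" if "norm x < a \<or> b < norm x" for x
  proof -
    have "(f has_derivative (\<lambda>h. 0)) (at x)"
    proof (rule has_derivative_transform_within_open)
      show "open ({x. norm x < a} \<union> {x. b < norm x} :: 'a set)"
        by (intro open_Un open_Collect_less continuous_intros)
      show "0 = f y" if "y \<in> {x. norm x < a} \<union> {x. b < norm x}" for y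
        using ab(2)[of y] that by fastforce
    qed (use that in auto)
    then show ?thesis by (rule euler_eqI)
  qed
  then have "\<forall>x. euler f x \<noteq> 0 \<longrightarrow> a \<le> norm x \<and> norm x \<le> b"
    by (meson not_le)
  ultimately show ?thesis
    using \<open>a > 0\<close> unfolding test_fun_def by blast
qed

lemma test_fun_euler_funpow: "test_fun (k + l) f \<Longrightarrow> test_fun k ((euler ^^ l) f)"
  by (induction l arbitrary: k) (auto intro: test_fun_euler)

lemma test_fun_mult_left:
  fixes f g :: "'a::euclidean_space \<Rightarrow> real"
  assumes "Ck_on k g (UNIV - {0})" "test_fun k f"
  shows "test_fun k (\<lambda>x. g x * f x)"
  using assms unfolding test_fun_def by (auto intro!: Ck_on_mult simp: open_delete)

lemma test_fun_cmult: "test_fun k f \<Longrightarrow> test_fun k (\<lambda>x. c * f x)"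
  by (intro test_fun_mult_left Ck_on_const) (auto simp: open_delete)

lemma test_fun_norm_powr: "test_fun k f \<Longrightarrow> test_fun k (\<lambda>x. norm x powr \<gamma> * f x)"
  by (intro test_fun_mult_left Ck_on_norm_powr)

lemma test_fun_mult: "test_fun k f \<Longrightarrow> test_fun k g \<Longrightarrow> test_fun k (\<lambda>x. f x * g x)"
  by (intro test_fun_mult_left) (auto simp: test_fun_def)

lemma test_fun_add:
  assumes "test_fun k f" "test_fun k g"
  shows "test_fun k (\<lambda>x. f x + g x)"
proof -
  obtain a b where 1: "a > 0" "\<And>x. f x \<noteq> 0 \<Longrightarrow> a \<le> norm x \<and> norm x \<le> b"
    using assms unfolding test_fun_def by blast
  obtain a' b' where 2: "a' > 0" "\<And>x. g x \<noteq> 0 \<Longrightarrow> a' \<le> norm x \<and> norm x \<le> b'"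
    using assms unfolding test_fun_def by blast
  have "min a a' \<le> norm x \<and> norm x \<le> max b b'" if "f x + g x \<noteq> 0" for x
    using 1(2)[of x] 2(2)[of x] that by (cases "f x = 0") auto
  moreover have "min a a' > 0" using 1 2 by simp
  moreover have "Ck_on k (\<lambda>x. f x + g x) (UNIV - {0})"
    using assms by (auto simp: test_fun_def open_delete intro!: Ck_on_add)
  ultimately show ?thesis unfolding test_fun_def by blast
qed

lemma test_fun_integrable:
  assumes "test_fun k f"
  shows "f integrable_on UNIV"
proof -
  obtain b where b: "\<And>x. f x \<noteq> 0 \<Longrightarrow> norm x \<le> b"
    using assms unfolding test_fun_def by blast
  obtain c where c: "cball (0::'a) b \<subseteq> cbox (- c) c"
    using bounded_subset_cbox_symmetric[OF bounded_cball] by blast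
  have "f integrable_on cbox (- c) c"
    using test_fun_continuous[OF assms] continuous_on_subset integrable_continuous by blast
  moreover have "f x = 0" if "x \<notin> cbox (- c) c" for x
    using b[of x] subsetD[OF c, of x] that by auto
  ultimately show ?thesis
    using integrable_on_superset by blast
qed

section \<open>Calculus rules for the Euler field\<close>

lemma euler_mult:
  assumes "test_fun (Suc k) f" "test_fun (Suc k) g"
  shows "euler (\<lambda>x. f x * g x) x = f x * euler g x + euler f x * g x"
  unfolding euler_def[of f] euler_def[of g]
  by (rule euler_eqI has_derivative_mult test_fun_has_derivative assms)+

lemma euler_add_cmult:
  assumes "test_fun (Suc k) f" "test_fun (Suc k) g"
  shows "euler (\<lambda>x. f x + c * g x) x = euler f x + c * euler g x"
  unfolding euler_def[of f] euler_def[of g]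
  by (rule euler_eqI)
    (intro has_derivative_add has_derivative_mult_right test_fun_has_derivative[OF assms(1)]
      test_fun_has_derivative[OF assms(2)])

lemma has_derivative_norm_powr_mult:
  fixes f :: "'a::euclidean_space \<Rightarrow> real"
  assumes "test_fun (Suc k) f" "x \<noteq> 0"
  shows "((\<lambda>x. norm x powr \<gamma> * f x) has_derivative
    (\<lambda>h. norm x powr \<gamma> * frechet_derivative f (at x) h
      + \<gamma> * norm x powr (\<gamma> - 2) * (x \<bullet> h) * f x)) (at x)"
  by (rule has_derivative_mult has_derivative_norm_powr test_fun_has_derivative assms)+

text \<open>The power r^\<gamma> is homogeneous of degree \<gamma>, hence an eigenfunction of
  \<theta> with eigenvalue \<gamma>. At the origin both sides are 0, because the product vanishes
  near it and \<open>0 powr \<gamma> = 0\<close>.\<close>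

lemma euler_norm_powr_mult:
  assumes "test_fun (Suc k) f"
  shows "euler (\<lambda>x. norm x powr \<gamma> * f x) x = norm x powr \<gamma> * (euler f x + \<gamma> * f x)"
proof (cases "x = 0")
  case True
  then show ?thesis
    using test_fun_at_0[OF test_fun_euler[OF test_fun_norm_powr[OF assms]], of \<gamma>] by simp
next
  case False
  have "norm x powr (\<gamma> - 2) * (x \<bullet> x) = norm x powr \<gamma>"
    using False by (simp add: dot_square_norm powr_diff)
  then show ?thesis
    using euler_eqI[OF has_derivative_norm_powr_mult[OF assms False], of \<gamma>]
    by (simp add: euler_def[of f] algebra_simps)
qed

section \<open>Integration by parts for the Euler field\<close>

lemma integral_eq_integral_UNIV:
  fixes f :: "'a::euclidean_space \<Rightarrow> 'b::banach"
  assumes "\<And>x. x \<notin> S \<Longrightarrow> f x = 0"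
  shows "integral S f = integral UNIV f"
proof -
  have "(\<lambda>x. if x \<in> S then f x else 0) = f" using assms by auto
  then show ?thesis using integral_restrict_UNIV[of S f] by simp
qed

text \<open>Differentiate \<open>\<integral> g (t x) dx = t\<^sup>-\<^sup>n \<integral> g\<close> with respect to \<open>t\<close> at \<open>t = 1\<close>.\<close>
lemma integral_euler:
  fixes g :: "'a::euclidean_space \<Rightarrow> real"
  assumes g: "test_fun (Suc 0) g"
  shows "integral UNIV (euler g) = - real DIM('a) * integral UNIV g"
proof -
  obtain b where b: "\<And>x. g x \<noteq> 0 \<Longrightarrow> norm x \<le> b"
    using g unfolding test_fun_def by blast
  obtain b' where b': "\<And>x. euler g x \<noteq> 0 \<Longrightarrow> norm x \<le> b'"
    using test_fun_euler[OF g] unfolding test_fun_def by blast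
  \<comment> \<open>If \<open>g (t *\<^sub>R x)\<close> is nonzero and t is at least 1/2, then |x|
    is at most 2b. One box thus serves all dilations with t in [1/2, 2]; the maximum with
    \<open>b'\<close> lets it carry \<open>euler g\<close> as well.\<close>
  define r where "r = 2 * max b b'"
  obtain c where c: "cball (0::'a) r \<subseteq> cbox (- c) c"
    using bounded_subset_cbox_symmetric[OF bounded_cball] by blast
  define I where "I = integral UNIV g"
  have van: "g (t *\<^sub>R x) = 0" if "t \<in> {1/2..2}" "x \<notin> cbox (- c) c" for t x
  proof (rule ccontr)
    assume "g (t *\<^sub>R x) \<noteq> 0"
    then have "t * norm x \<le> b" using b[of "t *\<^sub>R x"] that by simp
    moreover have "(1/2) * norm x \<le> t * norm x"
      using that by (intro mult_right_mono) auto
    ultimately have "norm x \<le> r" by (simp add: r_def)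
    then show False using c that by auto
  qed
  have "(g has_integral I) UNIV"
    unfolding I_def using test_fun_integrable[OF g] by (rule integrable_integral)
  moreover have "(\<lambda>x. if x \<in> cbox (- c) c then g x else 0) = g"
    using van[of 1] by auto
  ultimately have gI: "(g has_integral I) (cbox (- c) c)"
    using has_integral_restrict_UNIV[of "cbox (- c) c" g I] by simp
  have scaled: "integral (cbox (- c) c) (\<lambda>x. g (t *\<^sub>R x)) = I * inverse t ^ DIM('a)"
    if t: "t \<in> {1/2..2}" for t
  proof -
    have "((\<lambda>x. g (t *\<^sub>R x)) has_integral (I /\<^sub>R t ^ DIM('a))) (cbox ((- c) /\<^sub>R t) (c /\<^sub>R t))"
      using has_integral_affinity'[OF gI, of t 0] t by simp
    then have "((\<lambda>x. g (t *\<^sub>R x)) has_integral (I /\<^sub>R t ^ DIM('a))) UNIV"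
    proof (rule has_integral_on_superset)
      fix x assume x: "x \<notin> cbox ((- c) /\<^sub>R t) (c /\<^sub>R t)"
      have "t *\<^sub>R x \<notin> cbox (- c) c"
        using x t by (auto simp: mem_box field_simps)
      then show "g (t *\<^sub>R x) = 0" using van[of 1 "t *\<^sub>R x"] by simp
    qed auto
    then have "integral UNIV (\<lambda>x. g (t *\<^sub>R x)) = I /\<^sub>R t ^ DIM('a)"
      by (rule integral_unique)
    moreover have "integral (cbox (- c) c) (\<lambda>x. g (t *\<^sub>R x)) = integral UNIV (\<lambda>x. g (t *\<^sub>R x))"
      using van[OF t] by (rule integral_eq_integral_UNIV)
    ultimately show ?thesis by (simp add: power_inverse mult.commute)
  qed
  have cont_g: "continuous_on UNIV g" and cont_eg: "continuous_on UNIV (euler g)"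
    using test_fun_continuous g test_fun_euler by blast+
  have "((\<lambda>t. integral (cbox (- c) c) (\<lambda>x. g (t *\<^sub>R x))) has_field_derivative
      integral (cbox (- c) c) (\<lambda>x. euler g (1 *\<^sub>R x) / 1)) (at 1 within {1/2..2})"
  proof (rule leibniz_rule_field_derivative[where fx="\<lambda>t x. euler g (t *\<^sub>R x) / t"])
    fix t :: real and x :: 'a assume t: "t \<in> {1/2..2}"
    have lin: "linear (frechet_derivative g (at (t *\<^sub>R x)))"
      using test_fun_has_derivative[OF g] by (rule has_derivative_linear)
    have "((\<lambda>t. g (t *\<^sub>R x)) has_derivative
        (\<lambda>h. frechet_derivative g (at (t *\<^sub>R x)) (h *\<^sub>R x))) (at t within {1/2..2})"
      by (rule has_derivative_compose[OF _ test_fun_has_derivative[OF g]])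
        (auto intro!: derivative_eq_intros)
    \<comment> \<open>The chain rule gives direction x, while the Euler field at the point t x has
      direction t x; hence the division by t.\<close>
    moreover have "frechet_derivative g (at (t *\<^sub>R x)) (h *\<^sub>R x) = euler g (t *\<^sub>R x) / t * h" for h
      using t by (simp add: euler_def linear_scale[OF lin])
    then have "(\<lambda>h. frechet_derivative g (at (t *\<^sub>R x)) (h *\<^sub>R x)) = (*) (euler g (t *\<^sub>R x) / t)"
      by (rule ext)
    ultimately show "((\<lambda>t. g (t *\<^sub>R x)) has_field_derivative euler g (t *\<^sub>R x) / t)
        (at t within {1/2..2})"
      unfolding has_field_derivative_def by (simp only:)
  next
    fix t :: real
    show "(\<lambda>x. g (t *\<^sub>R x)) integrable_on cbox (- c) c"
      by (intro integrable_continuous continuous_on_compose2[OF cont_g]) (auto intro: continuous_intros)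
  next
    show "continuous_on ({1/2..2} \<times> cbox (- c) c) (\<lambda>(t, x). euler g (t *\<^sub>R x) / t)"
      unfolding split_beta
      by (intro continuous_intros continuous_on_compose2[OF cont_eg]) auto
  qed auto
  moreover have "integral (cbox (- c) c) (euler g) = integral UNIV (euler g)"
  proof (rule integral_eq_integral_UNIV)
    fix x assume "x \<notin> cbox (- c) c"
    then have "\<not> norm x \<le> r" using c by auto
    \<comment> \<open>A norm at most \<open>b'\<close> would force \<open>b'\<close> to be
      nonnegative, hence at most \<open>r\<close>.\<close>
    then have "\<not> norm x \<le> b'"
      using order_trans[OF norm_ge_zero, of x b'] by (auto simp: r_def)
    then show "euler g x = 0" using b' by blast
  qed
  ultimately have "((\<lambda>t. integral (cbox (- c) c) (\<lambda>x. g (t *\<^sub>R x))) has_field_derivative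
      integral UNIV (euler g)) (at 1 within {1/2..2})"
    by simp
  then have "((\<lambda>t. I * inverse t ^ DIM('a)) has_field_derivative
      integral UNIV (euler g)) (at 1 within {1/2..2})"
    by (rule has_field_derivative_transform_within[OF _ zero_less_one]) (auto simp: scaled)
  \<comment> \<open>Since 1 is interior to [1/2, 2], the derivative within the interval is the full
    one, and uniqueness equates it with the explicit value -n I.\<close>
  then have "((\<lambda>t. I * inverse t ^ DIM('a)) has_field_derivative integral UNIV (euler g)) (at 1)"
    by (subst (asm) at_within_interior) auto
  moreover have "((\<lambda>t. I * inverse t ^ DIM('a)) has_field_derivative
      I * - real DIM('a)) (at 1)"
    by (auto intro!: derivative_eq_intros)
  ultimately show ?thesis
    using DERIV_unique I_def by fastforce
qed

section \<open>Conjugation to the dilation invariant norm\<close>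

definition log_norm2 :: "('a::euclidean_space \<Rightarrow> real) \<Rightarrow> real" where
  "log_norm2 f = wnorm2 (real DIM('a)) f"

lemma log_norm2_eq:
  "log_norm2 f = integral UNIV (\<lambda>x::'a::euclidean_space. norm x powr - real DIM('a) * (f x * f x))"
  by (simp add: log_norm2_def wnorm2_def power2_eq_square mult.commute)

text \<open>Skew-adjointness on the diagonal: integrate \<theta>(r^-n f^2) = 2 r^-n f \<theta>f - n
  r^-n f^2. The weight r^-n is the one for which \<open>integral_euler\<close> cancels the f^2
  terms.\<close>

lemma integral_mult_euler_eq_0:
  fixes f :: "'a::euclidean_space \<Rightarrow> real"
  assumes f: "test_fun (Suc 0) f"
  shows "integral UNIV (\<lambda>x. norm x powr - real DIM('a) * (f x * euler f x)) = 0"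
proof -
  let ?w = "\<lambda>x::'a. norm x powr - real DIM('a)"
  let ?g = "\<lambda>x. ?w x * (f x * f x)"
  have ff: "test_fun (Suc 0) (\<lambda>x. f x * f x)" using f f by (rule test_fun_mult)
  have int: "(\<lambda>x. ?w x * (f x * euler f x)) integrable_on UNIV" "?g integrable_on UNIV"
    by (intro test_fun_integrable[of 0] test_fun_norm_powr test_fun_mult test_fun_euler
        test_fun_SucD[OF f] f)+
  have "euler ?g x = 2 * (?w x * (f x * euler f x)) - real DIM('a) * ?g x" for x
    unfolding euler_norm_powr_mult[OF ff] euler_mult[OF f f] by (simp add: algebra_simps)
  then have "euler ?g = (\<lambda>x. 2 * (?w x * (f x * euler f x)) - real DIM('a) * ?g x)"
    by (rule ext)
  then have "integral UNIV (euler ?g) =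
      2 * integral UNIV (\<lambda>x. ?w x * (f x * euler f x)) - real DIM('a) * integral UNIV ?g"
    using int by (simp add: integral_diff integrable_on_mult_right del: mult_minus_left)
  then show ?thesis
    using integral_euler[OF test_fun_norm_powr[OF ff], of "- real DIM('a)"] by simp
qed

text \<open>A Pythagorean identity, blind to the sign of c: the cross term 2c f \<theta>f integrates
  to 0.\<close>

lemma log_norm2_euler_add:
  fixes f :: "'a::euclidean_space \<Rightarrow> real"
  assumes f: "test_fun (Suc 0) f"
  shows "log_norm2 (\<lambda>x. euler f x + c * f x) = log_norm2 (euler f) + c\<^sup>2 * log_norm2 f"
proof -
  let ?w = "\<lambda>x::'a. norm x powr - real DIM('a)"
  have e: "test_fun 0 (euler f)" "test_fun 0 f"
    using f test_fun_euler test_fun_SucD by blast+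
  have int: "(\<lambda>x. ?w x * (f x * euler f x)) integrable_on UNIV"
    "(\<lambda>x. ?w x * (euler f x * euler f x)) integrable_on UNIV"
    "(\<lambda>x. ?w x * (f x * f x)) integrable_on UNIV"
    by (intro test_fun_integrable[of 0] test_fun_norm_powr test_fun_mult e)+
  have "(\<lambda>x. ?w x * ((euler f x + c * f x) * (euler f x + c * f x))) =
      (\<lambda>x. ?w x * (euler f x * euler f x) + c\<^sup>2 * (?w x * (f x * f x))
        + 2 * c * (?w x * (f x * euler f x)))"
    by (rule ext) (simp add: algebra_simps power2_eq_square)
  then show ?thesis
    unfolding log_norm2_eq
    using int integral_mult_euler_eq_0[OF f]
    by (simp add: integral_add integrable_add integrable_on_mult_right)
qed

text \<open>The product \<open>(\<theta> - c) (\<theta> + d)\<close>, expanded.\<close>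
definition conj_lap :: "real \<Rightarrow> ('a::euclidean_space \<Rightarrow> real) \<Rightarrow> 'a \<Rightarrow> real" where
  "conj_lap \<beta> f x = euler (euler f) x + (\<beta> + 2) * euler f x + - Acoef (real DIM('a)) \<beta> * f x"

lemma test_fun_conj_lap:
  assumes "test_fun (Suc (Suc k)) f"
  shows "test_fun k (conj_lap \<beta> f)"
  unfolding conj_lap_def
  by (intro test_fun_add test_fun_cmult test_fun_euler assms test_fun_SucD[OF assms]
      test_fun_SucD[OF test_fun_SucD[OF assms]])

lemma log_norm2_conj_lap:
  fixes f :: "'a::euclidean_space \<Rightarrow> real"
  assumes f: "test_fun 2 f"
  shows "log_norm2 (conj_lap \<beta> f) = log_norm2 (euler (euler f))
    + Dcoef (real DIM('a)) \<beta> * log_norm2 (euler f) + (Acoef (real DIM('a)) \<beta>)\<^sup>2 * log_norm2 f"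
proof -
  \<comment> \<open>This c is the negative of the one in the overview: the factors are \<theta> + c
    and \<theta> + d, with c + d = \<beta> + 2 and c d = -A. The Pythagorean identity is then
    applied to g with c, and to \<open>euler f\<close> and f with d.\<close>
  define c d where "c = (4 + \<beta> - real DIM('a)) / 2" and "d = (real DIM('a) + \<beta>) / 2"
  define g where "g = (\<lambda>x. euler f x + d * f x)"
  have f2: "test_fun (Suc (Suc 0)) f" using f by (simp add: numeral_2_eq_2)
  have f1: "test_fun (Suc 0) f" and e1: "test_fun (Suc 0) (euler f)"
    using f2 test_fun_SucD test_fun_euler by blast+
  have g1: "test_fun (Suc 0) g"
    unfolding g_def by (intro test_fun_add test_fun_cmult f1 e1)
  have eg: "euler g = (\<lambda>x. euler (euler f) x + d * euler f x)"
    unfolding g_def by (rule ext) (rule euler_add_cmult[OF e1 f1])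
  have "conj_lap \<beta> f = (\<lambda>x. euler g x + c * g x)"
    by (rule ext)
      (simp add: conj_lap_def eg, simp add: g_def c_def d_def Acoef_def field_simps)
  then have "log_norm2 (conj_lap \<beta> f) = log_norm2 (euler (euler f)) + d\<^sup>2 * log_norm2 (euler f)
      + c\<^sup>2 * (log_norm2 (euler f) + d\<^sup>2 * log_norm2 f)"
    using log_norm2_euler_add[OF g1, of c] log_norm2_euler_add[OF e1, of d]
      log_norm2_euler_add[OF f1, of d] by (simp add: eg) (simp add: g_def)
  then show ?thesis
    by (simp add: c_def d_def Acoef_def Dcoef_def field_simps power2_eq_square)
qed

text \<open>A polynomial in \<theta> with constant coefficients commutes with \<theta>. This is what
  conjugation gains: powers of \<theta> can be moved past the Laplacian when it is iterated.\<close>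

lemma euler_conj_lap:
  assumes f: "test_fun (Suc (Suc (Suc 0))) f"
  shows "euler (conj_lap \<beta> f) = conj_lap \<beta> (euler f)"
proof
  fix x
  have f1: "test_fun (Suc 0) f" "test_fun (Suc 0) (euler f)" "test_fun (Suc 0) (euler (euler f))"
    using f test_fun_SucD test_fun_euler by blast+
  show "euler (conj_lap \<beta> f) x = conj_lap \<beta> (euler f) x"
    unfolding conj_lap_def
    by (subst euler_add_cmult[OF _ f1(1)], intro test_fun_add test_fun_cmult f1)
      (simp only: euler_add_cmult[OF f1(3,2)])
qed

lemma euler_funpow_conj_lap:
  assumes "test_fun (Suc (Suc l)) f"
  shows "(euler ^^ l) (conj_lap \<beta> f) = conj_lap \<beta> ((euler ^^ l) f)"
  using assms
proof (induction l)
  case (Suc l)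
  then have "test_fun (Suc (Suc (Suc 0))) ((euler ^^ l) f)"
    by (intro test_fun_euler_funpow) simp
  then show ?case
    using Suc.IH[OF test_fun_SucD[OF Suc.prems]] by (simp add: euler_conj_lap)
qed simp

section \<open>The radial operators after conjugation\<close>

lemma radial_deriv_norm_powr_mult:
  assumes "test_fun (Suc k) f"
  shows "radial_deriv (\<lambda>x. norm x powr \<gamma> * f x) = (\<lambda>x. norm x powr (\<gamma> - 1) * (euler f x + \<gamma> * f x))"
proof
  fix x
  let ?g = "\<lambda>x. norm x powr \<gamma> * f x"
  have "linear (frechet_derivative ?g (at x))"
    using test_fun_has_derivative[OF test_fun_norm_powr[OF assms]] by (rule has_derivative_linear)
  \<comment> \<open>This holds at the origin too, where both sides are 0 by division by zero. The
    lemma can therefore equate functions and be used inside a second radial derivative.\<close>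
  then have "radial_deriv ?g x = euler ?g x / norm x"
    by (simp add: radial_deriv_def euler_def linear_scale divide_inverse mult.commute)
  then show "radial_deriv ?g x = norm x powr (\<gamma> - 1) * (euler f x + \<gamma> * f x)"
    by (simp add: euler_norm_powr_mult[OF assms] powr_diff)
qed

definition scale_to :: "real \<Rightarrow> ('a::euclidean_space \<Rightarrow> real) \<Rightarrow> 'a \<Rightarrow> real" where
  "scale_to \<beta> f x = norm x powr ((\<beta> - real DIM('a)) / 2) * f x"

lemma wnorm2_scale_to: "wnorm2 \<beta> (scale_to \<beta> f) = log_norm2 f"
  for f :: "'a::euclidean_space \<Rightarrow> real"
proof -
  have "\<bar>scale_to \<beta> f x\<bar>\<^sup>2 * norm x powr - \<beta> = \<bar>f x\<bar>\<^sup>2 * norm x powr - real DIM('a)" for x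
  proof -
    have "(norm x powr ((\<beta> - real DIM('a)) / 2))\<^sup>2 * norm x powr - \<beta> = norm x powr - real DIM('a)"
      by (simp add: power2_eq_square flip: powr_add)
    then show ?thesis
      by (simp add: scale_to_def power_mult_distrib mult_ac)
  qed
  then show ?thesis by (simp add: log_norm2_def wnorm2_def)
qed

text \<open>The weight exponent (\<alpha> + 2 - n)/2 is the negative of the coefficient in
  \<open>Top \<alpha>\<close>, so the zero-order terms cancel; the factor 1/r lowers the weight from
  \<alpha> + 2 to \<alpha>.\<close>

lemma Top_scale_to:
  assumes "test_fun (Suc k) f"
  shows "Top \<alpha> (scale_to (\<alpha> + 2) f) = scale_to \<alpha> (euler f)"
proof
  fix x :: 'a
  define \<gamma> where "\<gamma> = (\<alpha> + 2 - real DIM('a)) / 2"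
  have "(real DIM('a) - 2 - \<alpha>) / (2 * norm x) = - \<gamma> / norm x"
    by (cases "x = 0") (simp_all add: \<gamma>_def field_simps)
  then have "Top \<alpha> (scale_to (\<alpha> + 2) f) x =
      norm x powr (\<gamma> - 1) * (euler f x + \<gamma> * f x) - \<gamma> / norm x * (norm x powr \<gamma> * f x)"
    unfolding Top_def scale_to_def \<gamma>_def[symmetric] radial_deriv_norm_powr_mult[OF assms] by simp
  also have "\<dots> = norm x powr (\<gamma> - 1) * euler f x"
    by (simp add: powr_diff distrib_left add_divide_distrib)
  also have "\<gamma> - 1 = (\<alpha> - real DIM('a)) / 2" by (simp add: \<gamma>_def field_simps)
  finally show "Top \<alpha> (scale_to (\<alpha> + 2) f) x = scale_to \<alpha> (euler f) x"
    by (simp only: scale_to_def[of \<alpha>])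
qed

text \<open>The parameters in \<open>Rop\<close> rise by 2 because each factor lowers the weight by
  2: every factor meets the weight at which it turns into \<theta>.\<close>

lemma Rop_scale_to:
  assumes "test_fun (Suc k) f"
  shows "Rop \<alpha> k (scale_to (\<alpha> + 2 * real k + 2) f) = scale_to \<alpha> ((euler ^^ Suc k) f)"
  using assms
proof (induction k arbitrary: \<alpha>)
  case 0
  then show ?case by (simp add: Top_scale_to)
next
  case (Suc k)
  have "Rop (\<alpha> + 2) k (scale_to (\<alpha> + 2 * real (Suc k) + 2) f) =
      scale_to (\<alpha> + 2) ((euler ^^ Suc k) f)"
    using Suc.IH[of "\<alpha> + 2"] test_fun_SucD[OF Suc.prems] by (simp add: algebra_simps)
  moreover have "test_fun (Suc 0) ((euler ^^ Suc k) f)"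
    using Suc.prems by (intro test_fun_euler_funpow) simp
  ultimately show ?case
    by (simp add: Top_scale_to del: of_nat_Suc)
qed

text \<open>Two radial derivatives give r^(\<gamma>-2) (\<theta> + \<gamma> - 1)(\<theta> +
  \<gamma>) f, and the first-order term turns \<gamma> - 1 into \<gamma> + n - 2. For this \<gamma>
  the two constants are (4 + \<beta> - n)/2 and (n + \<beta>)/2, the factors of
  \<open>conj_lap\<close>.\<close>

lemma radial_lap_scale_to:
  assumes f: "test_fun (Suc (Suc k)) f"
  shows "radial_lap (scale_to (\<beta> + 4) f) = scale_to \<beta> (conj_lap \<beta> f)"
proof
  fix x :: 'a
  define n where "n = real DIM('a)"
  define \<gamma> where "\<gamma> = (\<beta> + 4 - n) / 2"
  define g where "g = (\<lambda>x. euler f x + \<gamma> * f x)"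
  have f1: "test_fun (Suc k) f" "test_fun (Suc k) (euler f)"
    using f test_fun_SucD test_fun_euler by blast+
  have g: "test_fun (Suc k) g"
    unfolding g_def by (intro test_fun_add test_fun_cmult f1)
  have eg: "euler g x = euler (euler f) x + \<gamma> * euler f x"
    unfolding g_def by (rule euler_add_cmult[OF f1(2,1)])
  have "radial_deriv (scale_to (\<beta> + 4) f) = (\<lambda>x. norm x powr (\<gamma> - 1) * g x)"
    unfolding scale_to_def \<gamma>_def n_def g_def by (rule radial_deriv_norm_powr_mult[OF f])
  then have "radial_lap (scale_to (\<beta> + 4) f) x =
      norm x powr (\<gamma> - 1 - 1) * (euler g x + (\<gamma> - 1) * g x)
      + (n - 1) / norm x * (norm x powr (\<gamma> - 1) * g x)"
    unfolding radial_lap_def by (simp add: radial_deriv_norm_powr_mult[OF g] n_def)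
  also have "\<dots> = norm x powr (\<gamma> - 1 - 1) * (euler g x + (\<gamma> + n - 2) * g x)"
    unfolding powr_diff[of _ "\<gamma> - 1" 1] by (simp add: algebra_simps add_divide_distrib diff_divide_distrib)
  also have "\<gamma> - 1 - 1 = (\<beta> - n) / 2" by (simp add: \<gamma>_def field_simps)
  also have "euler g x + (\<gamma> + n - 2) * g x = conj_lap \<beta> f x"
    unfolding eg conj_lap_def unfolding g_def \<gamma>_def Acoef_def n_def by (simp add: field_simps)
  finally show "radial_lap (scale_to (\<beta> + 4) f) x = scale_to \<beta> (conj_lap \<beta> f) x"
    by (simp only: scale_to_def[of \<beta>] n_def)
qed

section \<open>The coefficient recursion and the iterated Laplacian\<close>

lemma Ccoef_eq_0: "j < 0 \<or> j > 2 * int k \<Longrightarrow> Ccoef n j k \<alpha> = 0"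
  by (cases k) auto

text \<open>At the top index the other two terms of the recursion fall outside the range, so only
  the one with A^2 survives.\<close>

lemma Ccoef_top: "Ccoef n (2 * int m) m \<alpha> = (\<Prod>l<m. (Acoef n (\<alpha> + 4 * real l))\<^sup>2)"
  by (induction m) (auto simp: Ccoef_eq_0 mult.commute)

text \<open>Here y k stands for the squared norm of \<theta>^k f; the right side is what one more
  Laplacian produces.\<close>

lemma sum_Ccoef_Suc:
  "(\<Sum>j\<le>2 * Suc m. Ccoef n (int j) (Suc m) \<alpha> * y (2 * Suc m - j)) =
   (\<Sum>j\<le>2 * m. Ccoef n (int j) m \<alpha> * (y (2 * m - j + 2)
      + Dcoef n (\<alpha> + 4 * real m) * y (2 * m - j + 1)
      + (Acoef n (\<alpha> + 4 * real m))\<^sup>2 * y (2 * m - j)))"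
proof -
  let ?C = "\<lambda>j::int. Ccoef n j m \<alpha>"
  let ?A = "(Acoef n (\<alpha> + 4 * real m))\<^sup>2" and ?D = "Dcoef n (\<alpha> + 4 * real m)"
  let ?M = "2 * m"
  \<comment> \<open>Each shifted sum has two surplus terms, which vanish as out of range: the last
    two here, one at each end in the next sum, the first two in the third.\<close>
  have 0: "(\<Sum>j\<le>Suc (Suc ?M). ?C (int j) * y (Suc (Suc ?M) - j)) = (\<Sum>j\<le>?M. ?C (int j) * y (?M - j + 2))"
    by (simp add: Ccoef_eq_0 Suc_diff_le)
  have 1: "(\<Sum>j\<le>Suc (Suc ?M). ?C (int j - 1) * y (Suc (Suc ?M) - j)) = (\<Sum>j\<le>?M. ?C (int j) * y (?M - j + 1))"
    by (subst sum.atMost_Suc_shift) (simp add: Ccoef_eq_0 Suc_diff_le)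
  have 2: "(\<Sum>j\<le>Suc (Suc ?M). ?C (int j - 2) * y (Suc (Suc ?M) - j)) = (\<Sum>j\<le>?M. ?C (int j) * y (?M - j))"
    by (subst sum.atMost_Suc_shift, subst sum.atMost_Suc_shift) (simp add: Ccoef_eq_0)
  have "(\<Sum>j\<le>2 * Suc m. Ccoef n (int j) (Suc m) \<alpha> * y (2 * Suc m - j)) =
     (\<Sum>j\<le>Suc (Suc ?M). ?A * (?C (int j - 2) * y (Suc (Suc ?M) - j))
       + ?D * (?C (int j - 1) * y (Suc (Suc ?M) - j)) + ?C (int j) * y (Suc (Suc ?M) - j))"
    by (rule sum.cong) (auto simp: algebra_simps)
  also have "\<dots> = ?A * (\<Sum>j\<le>?M. ?C (int j) * y (?M - j)) + ?D * (\<Sum>j\<le>?M. ?C (int j) * y (?M - j + 1))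
       + (\<Sum>j\<le>?M. ?C (int j) * y (?M - j + 2))"
    unfolding sum.distrib sum_distrib_left[symmetric] 0 1 2 ..
  finally show ?thesis
    by (simp add: sum.distrib sum_distrib_left algebra_simps)
qed

text \<open>The induction peels off the innermost Laplacian, which acts at weight \<alpha> + 4m, the
  parameter in the coefficient recursion. It replaces f by \<open>conj_lap \<beta> f\<close>, so f
  must be arbitrary while \<alpha> stays fixed.\<close>

lemma wnorm2_radial_lap_funpow:
  fixes f :: "'a::euclidean_space \<Rightarrow> real"
  assumes "test_fun (2 * m) f"
  shows "wnorm2 \<alpha> ((radial_lap ^^ m) (scale_to (\<alpha> + 4 * real m) f)) =
    (\<Sum>j\<le>2 * m. Ccoef (real DIM('a)) (int j) m \<alpha> * log_norm2 ((euler ^^ (2 * m - j)) f))"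
  using assms
proof (induction m arbitrary: f)
  case 0
  show ?case by (simp add: wnorm2_scale_to)
next
  case (Suc m)
  define \<beta> where "\<beta> = \<alpha> + 4 * real m"
  have f: "test_fun (Suc (Suc (2 * m))) f" using Suc.prems by simp
  have "(radial_lap ^^ Suc m) (scale_to (\<alpha> + 4 * real (Suc m)) f) =
      (radial_lap ^^ m) (scale_to \<beta> (conj_lap \<beta> f))"
    using radial_lap_scale_to[OF f, of \<beta>] by (simp add: \<beta>_def funpow_swap1 algebra_simps)
  then have "wnorm2 \<alpha> ((radial_lap ^^ Suc m) (scale_to (\<alpha> + 4 * real (Suc m)) f)) =
      (\<Sum>j\<le>2 * m. Ccoef (real DIM('a)) (int j) m \<alpha> * log_norm2 ((euler ^^ (2 * m - j)) (conj_lap \<beta> f)))"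
    using Suc.IH[OF test_fun_conj_lap[OF f], of \<beta>] by (simp add: \<beta>_def)
  also have "\<dots> = (\<Sum>j\<le>2 * m. Ccoef (real DIM('a)) (int j) m \<alpha> *
     (log_norm2 ((euler ^^ (2 * m - j + 2)) f)
      + Dcoef (real DIM('a)) \<beta> * log_norm2 ((euler ^^ (2 * m - j + 1)) f)
      + (Acoef (real DIM('a)) \<beta>)\<^sup>2 * log_norm2 ((euler ^^ (2 * m - j)) f)))"
  proof (rule sum.cong[OF refl])
    fix j
    define l where "l = 2 * m - j"
    have "(euler ^^ l) (conj_lap \<beta> f) = conj_lap \<beta> ((euler ^^ l) f)"
      by (intro euler_funpow_conj_lap test_fun_mono[OF _ f]) (simp add: l_def)
    moreover have "test_fun 2 ((euler ^^ l) f)"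
      by (intro test_fun_euler_funpow test_fun_mono[OF _ f]) (simp add: l_def)
    ultimately show "Ccoef (real DIM('a)) (int j) m \<alpha> * log_norm2 ((euler ^^ (2 * m - j)) (conj_lap \<beta> f)) =
      Ccoef (real DIM('a)) (int j) m \<alpha> *
     (log_norm2 ((euler ^^ (2 * m - j + 2)) f)
      + Dcoef (real DIM('a)) \<beta> * log_norm2 ((euler ^^ (2 * m - j + 1)) f)
      + (Acoef (real DIM('a)) \<beta>)\<^sup>2 * log_norm2 ((euler ^^ (2 * m - j)) f))"
      by (simp add: log_norm2_conj_lap flip: l_def)
  qed
  also have "\<dots> = (\<Sum>j\<le>2 * Suc m. Ccoef (real DIM('a)) (int j) (Suc m) \<alpha> *
      log_norm2 ((euler ^^ (2 * Suc m - j)) f))"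
    unfolding \<beta>_def by (rule sum_Ccoef_Suc[symmetric])
  finally show ?case .
qed

theorem theorem1p1:
  fixes u :: "'a::euclidean_space \<Rightarrow> real" and m :: nat and \<alpha> :: real
  assumes "m \<ge> 1"
    and "Ck_on (2 * m) u (UNIV - {0})"
    and "compact_support_away_0 u"
  shows "wnorm2 \<alpha> ((radial_lap ^^ m) u) =
      (\<Prod>l<m. (Acoef (real DIM('a)) (\<alpha> + 4 * real l))^2) * wnorm2 (\<alpha> + 4 * real m) u
    + (\<Sum>j<2 * m. Ccoef (real DIM('a)) (int j) m \<alpha> *
         wnorm2 (\<alpha> + 2 * real j) (Rop (\<alpha> + 2 * real j) (2 * m - 1 - j) u))"
proof -
  define \<beta> where "\<beta> = \<alpha> + 4 * real m"
  \<comment> \<open>f is the preimage of u under \<open>scale_to \<beta>\<close>; \<beta> is the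
    weight that m Laplacians lower to \<alpha>.\<close>
  define f where "f = (\<lambda>x. norm x powr ((real DIM('a) - \<beta>) / 2) * u x)"
  have u: "test_fun (2 * m) u" using assms by (intro test_funI)
  have f: "test_fun (2 * m) f" unfolding f_def using u by (rule test_fun_norm_powr)
  have u_eq: "scale_to \<beta> f = u"
  proof
    fix x
    show "scale_to \<beta> f x = u x"
    proof (cases "x = 0")
      case True
      then show ?thesis using test_fun_at_0[OF u] by (simp add: scale_to_def)
    next
      case False
      have "norm x powr ((\<beta> - real DIM('a)) / 2) * norm x powr ((real DIM('a) - \<beta>) / 2)
          = norm x powr 0"
        unfolding powr_add[symmetric] by (rule arg_cong) (simp add: field_simps)
      with False show ?thesis by (simp add: scale_to_def f_def flip: mult.assoc)
    qed
  qed
  have R: "wnorm2 (\<alpha> + 2 * real j) (Rop (\<alpha> + 2 * real j) (2 * m - 1 - j) u) =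
      log_norm2 ((euler ^^ (2 * m - j)) f)" if "j < 2 * m" for j
  proof -
    define k where "k = 2 * m - 1 - j"
    \<comment> \<open>\<open>Rop\<close> with index k composes k + 1 operators, hence 2m - j Euler
      derivatives. The starting weight is \<beta> for every j, so the same f serves all
      terms.\<close>
    have k: "Suc k = 2 * m - j" "\<alpha> + 2 * real j + 2 * real k + 2 = \<beta>"
      using that by (auto simp: k_def \<beta>_def of_nat_diff)
    have "test_fun (Suc k) f" by (rule test_fun_mono[OF _ f]) (simp add: k)
    from Rop_scale_to[OF this, of "\<alpha> + 2 * real j"] show ?thesis
      unfolding k u_eq by (simp add: wnorm2_scale_to k_def)
  qed
  have "wnorm2 \<alpha> ((radial_lap ^^ m) u) =
      (\<Sum>j\<le>2 * m. Ccoef (real DIM('a)) (int j) m \<alpha> * log_norm2 ((euler ^^ (2 * m - j)) f))"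
    using wnorm2_radial_lap_funpow[OF f, of \<alpha>] by (simp add: u_eq flip: \<beta>_def)
  \<comment> \<open>The term j = 2m contains no derivative; \<open>Ccoef_top\<close> turns it into
    the product term.\<close>
  also have "\<dots> = Ccoef (real DIM('a)) (2 * int m) m \<alpha> * log_norm2 f
      + (\<Sum>j<2 * m. Ccoef (real DIM('a)) (int j) m \<alpha> * log_norm2 ((euler ^^ (2 * m - j)) f))"
    by (simp flip: lessThan_Suc_atMost)
  finally show ?thesis
    using wnorm2_scale_to[of \<beta> f] R by (simp add: Ccoef_top u_eq flip: \<beta>_def)
qed

end
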